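(* Let $\Omega\subset\mathbb{R}^2$ be a bounded closed Jordan domain contained in an open domain $\Omega_0\subset\mathbb{R}^2$, and let $f:\Omega_0\to\mathbb{R}$ be continuous and bounded on $\Omega_0$. Let $\mathring{\Omega}=\Omega\setminus\partial\Omega$ denote the interior of $\Omega$ and put $$a=\inf\{x \mid (x,y)\in\mathring{\Omega}\},\qquad b=\sup\{x\mid (x,y)\in\mathring{\Omega}\}.$$ For $x\in[a,b]$ let $\Omega_x=\{y \mid (x,y)\in\mathring{\Omega}\}$. Let $(E_\varepsilon)_{\varepsilon>0}$ be a nested family of square coverings of $\partial\Omega$ (as defined in the context), so that $E_\varepsilon\subset E_{\varepsilon'}$ whenever $\varepsilon<\varepsilon'$. Then the double integral of $f$ over $\Omega$ can be written as the repeated integral $$\int_\Omega f(x,y)\,dx\,dy=\int_a^b\left(\int_{\Omega_x}f(x,y)\,dy\right)dx,$$ where the outer integral is a Riemann integral and the inner integral is taken in the following improper meaning: $$\int_{\Omega_x}f(x,y)\,dy=\lim_{\varepsilon\to0}\int_{\Omega_x\setminus E_\varepsilon}f(x,y)\,dy .$$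
   Context: All integrals are Riemann integrals (the inner one in the improper meaning given in the claim). A closed Jordan domain is a bounded closed set in $\mathbb{R}^2$ with nonempty interior whose boundary has Jordan measure zero, i.e. for every $\varepsilon>0$ the boundary can be covered by finitely many squares with sides parallel to the coordinate axes and with sum of areas not exceeding $\varepsilon$. Nested family of square coverings of $\partial\Omega$: for each $\varepsilon>0$, $E_\varepsilon$ is the union of a finite family of squares with sides parallel to the coordinate axes which covers $\partial\Omega$, whose sum of areas does not exceed $\varepsilon$, such that each square of the family contains some point of $\partial\Omega$ and no square of the family contains another one; moreover $E_\varepsilon\subset E_{\varepsilon'}$ whenever $\varepsilon<\varepsilon'$. For fixed $x$, $\Omega_x\setminus E_\varepsilon$ denotes $\{y\in\Omega_x \mid (x,y)\notin E_\varepsilon\}$. *)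

theory Defs
  imports "HOL-Analysis.Analysis"
begin

section \<open>The Riemann integral\<close>

text \<open>
  The integral of the library is the Henstock--Kurzweil integral. Restricting its gauges to a
  uniform bound on the diameters of the cells yields the classical Riemann integral over a box;
  over a bounded set one integrates the extension by zero over boxes containing the set.
\<close>

definition has_riemann_integral_box ::
    "('a::euclidean_space \<Rightarrow> real) \<Rightarrow> real \<Rightarrow> 'a \<Rightarrow> 'a \<Rightarrow> bool"
  where "has_riemann_integral_box f I u v \<longleftrightarrow>
    (\<forall>e>0. \<exists>d>0. \<forall>D. D tagged_division_of cbox u v \<and> (\<forall>(x, K)\<in>D. diameter K < d) \<longrightarrow>
       \<bar>(\<Sum>(x, K)\<in>D. measure lborel K * f x) - I\<bar> < e)"

definition has_riemann_integral ::
    "('a::euclidean_space \<Rightarrow> real) \<Rightarrow> real \<Rightarrow> 'a set \<Rightarrow> bool"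
    (infixr \<open>has'_riemann'_integral\<close> 46)
  where "(f has_riemann_integral I) S \<longleftrightarrow> bounded S \<and>
    (\<forall>u v. S \<subseteq> cbox u v \<longrightarrow> has_riemann_integral_box (\<lambda>x. if x \<in> S then f x else 0) I u v)"

definition riemann_integrable_on ::
    "('a::euclidean_space \<Rightarrow> real) \<Rightarrow> 'a set \<Rightarrow> bool"
    (infixr \<open>riemann'_integrable'_on\<close> 46)
  where "f riemann_integrable_on S \<longleftrightarrow> (\<exists>I. (f has_riemann_integral I) S)"

definition riemann_integral :: "'a set \<Rightarrow> ('a::euclidean_space \<Rightarrow> real) \<Rightarrow> real"
  where "riemann_integral S f = (THE I. (f has_riemann_integral I) S)"

text \<open>
  Consistency with the library integral, which also shows that the value is unique, so that
  \<open>riemann_integral\<close> is meaningful for every Riemann integrable function.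
\<close>

lemma has_riemann_integral_imp_has_integral:
  assumes "(f has_riemann_integral I) S"
  shows "(f has_integral I) S"
proof -
  define g where "g = (\<lambda>x. if x \<in> S then f x else 0)"
  have "bounded S" using assms by (simp add: has_riemann_integral_def)
  then obtain u where u: "S \<subseteq> cbox (- u) u"
    using bounded_subset_cbox_symmetric by blast
  then have *: "has_riemann_integral_box g I (- u) u"
    using assms by (simp add: has_riemann_integral_def g_def)
  have "(g has_integral I) (cbox (- u) u)"
    unfolding has_integral
  proof (intro allI impI)
    fix e :: real assume "e > 0"
    then obtain d where d: "d > 0" and
      D: "\<And>D. D tagged_division_of cbox (- u) u \<Longrightarrow> (\<forall>(x, K)\<in>D. diameter K < d) \<Longrightarrow>
        \<bar>(\<Sum>(x, K)\<in>D. measure lborel K * g x) - I\<bar> < e"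
      using *[unfolded has_riemann_integral_box_def, rule_format, OF \<open>e > 0\<close>] by auto
    have small: "diameter K < d" if "K \<subseteq> ball x (d / 3)" for x :: 'a and K
    proof -
      have "diameter K \<le> diameter (ball x (d / 3))"
        using that by (intro diameter_subset) auto
      also have "\<dots> < d" using d by simp
      finally show ?thesis .
    qed
    show "\<exists>\<gamma>. gauge \<gamma> \<and> (\<forall>D. D tagged_division_of cbox (- u) u \<and> \<gamma> fine D \<longrightarrow>
        norm ((\<Sum>(x, K)\<in>D. measure lborel K *\<^sub>R g x) - I) < e)"
    proof (intro exI[of _ "\<lambda>x. ball x (d / 3)"] conjI allI impI)
      show "gauge (\<lambda>x::'a. ball x (d / 3))" using d by auto
      fix D assume *: "D tagged_division_of cbox (- u) u \<and> (\<lambda>x. ball x (d / 3)) fine D"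
      have "\<forall>(x, K)\<in>D. diameter K < d"
        using * small unfolding fine_def by blast
      with * have "\<bar>(\<Sum>(x, K)\<in>D. measure lborel K * g x) - I\<bar> < e"
        by (intro D) auto
      then show "norm ((\<Sum>(x, K)\<in>D. measure lborel K *\<^sub>R g x) - I) < e"
        by (simp only: real_norm_def real_scaleR_def)
    qed
  qed
  then show ?thesis
    using u unfolding g_def by (simp only: has_integral_restrict)
qed

lemma riemann_integral_unique:
  "(f has_riemann_integral I) S \<Longrightarrow> riemann_integral S f = I"
  unfolding riemann_integral_def
  by (rule the_equality)
    (auto dest!: has_riemann_integral_imp_has_integral intro: has_integral_unique)

section \<open>Jordan domains and square coverings in the plane\<close>

definition axis_square :: "(real \<times> real) set \<Rightarrow> bool"
  where "axis_square Q \<longleftrightarrow> (\<exists>p q s. s > 0 \<and> Q = {p..p + s} \<times> {q..q + s})"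

definition square_cover :: "(real \<times> real) set \<Rightarrow> real \<Rightarrow> (real \<times> real) set set \<Rightarrow> bool"
  where "square_cover A \<epsilon> F \<longleftrightarrow>
    finite F \<and> (\<forall>Q\<in>F. axis_square Q) \<and> A \<subseteq> \<Union>F \<and> (\<Sum>Q\<in>F. measure lborel Q) \<le> \<epsilon>"

definition jordan_measure_zero :: "(real \<times> real) set \<Rightarrow> bool"
  where "jordan_measure_zero A \<longleftrightarrow> (\<forall>\<epsilon>>0. \<exists>F. square_cover A \<epsilon> F)"

definition closed_jordan_domain :: "(real \<times> real) set \<Rightarrow> bool"
  where "closed_jordan_domain \<Omega> \<longleftrightarrow>
    bounded \<Omega> \<and> closed \<Omega> \<and> interior \<Omega> \<noteq> {} \<and> jordan_measure_zero (frontier \<Omega>)"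

definition nested_square_coverings ::
    "(real \<times> real) set \<Rightarrow> (real \<Rightarrow> (real \<times> real) set) \<Rightarrow> bool"
  where "nested_square_coverings \<Omega> E \<longleftrightarrow>
    (\<forall>\<epsilon>>0. \<exists>F. E \<epsilon> = \<Union>F \<and> square_cover (frontier \<Omega>) \<epsilon> F \<and>
       (\<forall>Q\<in>F. Q \<inter> frontier \<Omega> \<noteq> {}) \<and> (\<forall>Q\<in>F. \<forall>Q'\<in>F. Q \<noteq> Q' \<longrightarrow> \<not> Q \<subseteq> Q')) \<and>
    (\<forall>\<epsilon> \<epsilon>'. 0 < \<epsilon> \<and> \<epsilon> < \<epsilon>' \<longrightarrow> E \<epsilon> \<subseteq> E \<epsilon>')"

definition slice :: "(real \<times> real) set \<Rightarrow> real \<Rightarrow> real set"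
  where "slice A x = {y. (x, y) \<in> A}"

section \<open>The improper inner integral\<close>

definition inner_integral_approx ::
    "(real \<times> real) set \<Rightarrow> (real \<Rightarrow> (real \<times> real) set) \<Rightarrow> (real \<times> real \<Rightarrow> real) \<Rightarrow> real \<Rightarrow> real \<Rightarrow> real"
  where "inner_integral_approx \<Omega> E f x \<epsilon> =
    riemann_integral (slice (interior \<Omega>) x - slice (E \<epsilon>) x) (\<lambda>y. f (x, y))"

definition inner_integrable ::
    "(real \<times> real) set \<Rightarrow> (real \<Rightarrow> (real \<times> real) set) \<Rightarrow> (real \<times> real \<Rightarrow> real) \<Rightarrow> real \<Rightarrow> bool"
  where "inner_integrable \<Omega> E f x \<longleftrightarrow>
    (\<forall>\<epsilon>>0. (\<lambda>y. f (x, y)) riemann_integrable_on (slice (interior \<Omega>) x - slice (E \<epsilon>) x)) \<and>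
    (\<exists>L. (inner_integral_approx \<Omega> E f x \<longlongrightarrow> L) (at_right 0))"

definition inner_integral ::
    "(real \<times> real) set \<Rightarrow> (real \<Rightarrow> (real \<times> real) set) \<Rightarrow> (real \<times> real \<Rightarrow> real) \<Rightarrow> real \<Rightarrow> real"
  where "inner_integral \<Omega> E f x = Lim (at_right 0) (inner_integral_approx \<Omega> E f x)"

end

theory Submission
  imports Defs
begin

text \<open>
  A bounded measurable function that is continuous almost everywhere is Riemann integrable, with
  its Lebesgue integral as value: along divisions of vanishing mesh, the step functions built from
  the tags converge almost everywhere, and dominated convergence applies. Three integrands are of
  this kind. The double integrand is continuous off the null set \<open>\<partial>\<Omega>\<close>. The inner integrand over
  \<open>\<Omega>\<^sub>x \<setminus> E\<^sub>\<epsilon>\<close> is continuous off the finitely many end points of the slices of squares. Finally, as the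
  squares of \<open>E\<^sub>\<epsilon>\<close> meet \<open>\<partial>\<Omega>\<close> and have side at most \<open>\<surd>\<epsilon>\<close>, the sets \<open>\<Omega>\<^sub>x \<setminus> E\<^sub>\<epsilon>\<close> exhaust \<open>\<Omega>\<^sub>x\<close>, so the
  improper inner integral is the Lebesgue integral over \<open>\<Omega>\<^sub>x\<close>; by dominated convergence it is
  continuous in \<open>x\<close> wherever the slice of \<open>\<partial>\<Omega>\<close> is null, which is almost everywhere by Fubini.
\<close>

section \<open>Almost everywhere continuous functions\<close>

lemma measure_interior_cbox:
  fixes a b :: "'a::euclidean_space"
  shows "measure lborel (interior (cbox a b)) = measure lborel (cbox a b)"
  by (simp add: interior_cbox measure_lborel_box_eq measure_lborel_cbox_eq)

text \<open>The step function whose Lebesgue integral is the Riemann sum of \<open>D\<close>. Using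
  interiors of cells keeps the pieces disjoint; on the common faces the value is 0.\<close>

definition tag_step :: "('a::euclidean_space \<Rightarrow> real) \<Rightarrow> ('a \<times> 'a set) set \<Rightarrow> 'a \<Rightarrow> real"
  where "tag_step g D y = (\<Sum>(x, K)\<in>D. g x * indicator (interior K) y)"

text \<open>Distinct members of a division have disjoint interiors, so only one summand survives at
  \<open>y\<close>.\<close>

lemma tag_step_inside:
  assumes "D tagged_division_of S" "(x, K) \<in> D" "y \<in> interior K"
  shows "tag_step g D y = g x"
proof -
  have "tag_step g D y = (\<Sum>p\<in>D. if p = (x, K) then g x else 0)"
    unfolding tag_step_def
  proof (rule sum.cong, rule refl)
    fix p assume "p \<in> D"
    obtain x' K' where p: "p = (x', K')" by fastforce
    show "(case p of (x, K) \<Rightarrow> g x * indicator (interior K) y) = (if p = (x, K) then g x else 0)"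
    proof (cases "p = (x, K)")
      case True then show ?thesis using assms(3) by simp
    next
      case False
      then have "interior K' \<inter> interior K = {}"
        using tagged_division_ofD(5)[OF assms(1)] \<open>p \<in> D\<close> assms(2) unfolding p by blast
      then have "y \<notin> interior K'" using assms(3) by blast
      then show ?thesis using False unfolding p by auto
    qed
  qed
  also have "\<dots> = g x"
    using assms(2) tagged_division_ofD(1)[OF assms(1)] by simp
  finally show ?thesis .
qed

lemma tag_step_outside:
  assumes "\<And>x K. (x, K) \<in> D \<Longrightarrow> y \<notin> interior K"
  shows "tag_step g D y = 0"
  unfolding tag_step_def by (rule sum.neutral) (use assms in auto)

text \<open>Supplies an integrable majorant independent of the division, for dominated
  convergence.\<close>

lemma tag_step_bound:
  assumes D: "D tagged_division_of cbox u v" and M: "\<And>x. \<bar>g x\<bar> \<le> M"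
  shows "\<bar>tag_step g D y\<bar> \<le> M * indicator (cbox u v) y"
proof (cases "\<exists>x K. (x, K) \<in> D \<and> y \<in> interior K")
  case True
  then obtain x K where xK: "(x, K) \<in> D" "y \<in> interior K" by blast
  then have "y \<in> cbox u v"
    using tagged_division_ofD(3)[OF D xK(1)] interior_subset by blast
  then show ?thesis using tag_step_inside[OF D xK, of g] M by simp
next
  case False
  have "0 \<le> M" using M[of undefined] by linarith
  then show ?thesis using False by (subst tag_step_outside) auto
qed

lemma tag_step_measurable [measurable]: "tag_step g D \<in> borel_measurable borel"
  unfolding tag_step_def[abs_def]
  by (rule borel_measurable_sum) (auto intro!: borel_measurable_times borel_measurable_indicator)

text \<open>Passing from a cell to its interior does not change its measure, so termwise integration
  gives the Riemann sum.\<close>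

lemma integral_tag_step:
  assumes D: "D tagged_division_of cbox u v"
  shows "integral\<^sup>L lborel (tag_step g D) = (\<Sum>(x, K)\<in>D. measure lborel K * g x)"
proof -
  have K: "measure lborel (interior K) = measure lborel K"
    "integrable lborel (indicator (interior K) :: 'a \<Rightarrow> real)"
    if xK: "(x, K) \<in> D" for x K
  proof -
    obtain p q where "K = cbox p q" using tagged_division_ofD(4)[OF D xK] by blast
    then show "measure lborel (interior K) = measure lborel K"
      "integrable lborel (indicator (interior K) :: 'a \<Rightarrow> real)"
      using measure_interior_cbox[of p q] by (auto simp: emeasure_lborel_box_eq)
  qed
  have "integral\<^sup>L lborel (tag_step g D)
      = (\<Sum>p\<in>D. LINT y|lborel. g (fst p) * indicator (interior (snd p)) y)"
    unfolding tag_step_def[abs_def] case_prod_beta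
    by (rule Bochner_Integration.integral_sum) (use K in auto)
  also have "\<dots> = (\<Sum>(x, K)\<in>D. measure lborel K * g x)"
    by (rule sum.cong) (use K in \<open>auto simp: case_prod_beta\<close>)
  finally show ?thesis .
qed

text \<open>Dominated convergence concerns sequences, so a supposed failure is first turned into a
  sequence of divisions whose mesh tends to 0 while their sums stay at least \<open>e\<close> away
  from the integral. Their step functions converge almost everywhere to the integrand on the box,
  which is a contradiction.\<close>

lemma has_riemann_integral_box_AE_continuous:
  fixes g :: "'a::euclidean_space \<Rightarrow> real"
  assumes meas [measurable]: "g \<in> borel_measurable borel"
    and M: "\<And>x. \<bar>g x\<bar> \<le> M"
    and cont: "AE x in lborel. isCont g x"
  shows "has_riemann_integral_box g (LINT x|lborel. indicator (cbox u v) x * g x) u v"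
proof (rule ccontr)
  let ?I = "LINT x|lborel. indicator (cbox u v) x * g x"
  let ?R = "\<lambda>D. \<Sum>(x, K)\<in>D. measure lborel K * g x"
  define fine_div where "fine_div r D \<longleftrightarrow> D tagged_division_of cbox u v \<and> (\<forall>(x, K)\<in>D. diameter K < r)"
    for r D
  assume "\<not> ?thesis"
  then have "\<not> (\<forall>e>0. \<exists>r>0. \<forall>D. fine_div r D \<longrightarrow> \<bar>?R D - ?I\<bar> < e)"
    unfolding has_riemann_integral_box_def fine_div_def .
  then obtain e where "e > 0" and bad: "\<And>r. r > 0 \<Longrightarrow> \<exists>D. fine_div r D \<and> \<not> \<bar>?R D - ?I\<bar> < e"
    by blast
  have "\<forall>n. \<exists>D. fine_div (inverse (real (Suc n))) D \<and> \<not> \<bar>?R D - ?I\<bar> < e"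
    using bad by simp
  from choice[OF this] obtain D where
    fine: "\<And>n. fine_div (inverse (real (Suc n))) (D n)" and far: "\<And>n. \<not> \<bar>?R (D n) - ?I\<bar> < e"
    by blast
  have D: "D n tagged_division_of cbox u v" for n
    using fine[of n] by (simp add: fine_div_def)
  have small: "diameter K < inverse (real (Suc n))" if "(x, K) \<in> D n" for n x K
    using fine[of n] that by (auto simp: fine_div_def)
  \<comment> \<open>Cell boundaries are null, and countably many divisions with finitely many cells
    each involve only countably many of them. One null set thus serves for all
    \<open>n\<close>.\<close>
  have "AE y in lborel. y \<notin> frontier K" if xK: "(x, K) \<in> D n" for x K n
  proof -
    obtain p q where "K = cbox p q" using tagged_division_ofD(4)[OF D xK] by blast
    then have "negligible (frontier K)"
      by (simp add: negligible_convex_frontier)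
    then have "frontier K \<in> null_sets lborel"
      by (simp add: negligible_iff_null_sets null_sets_completion_iff)
    then show ?thesis by (rule AE_not_in)
  qed
  then have "AE y in lborel. \<forall>p\<in>D n. y \<notin> frontier (snd p)" for n
    using tagged_division_ofD(1)[OF D] by (subst AE_finite_all) auto
  then have "AE y in lborel. \<forall>n. \<forall>p\<in>D n. y \<notin> frontier (snd p)"
    by (simp add: AE_all_countable)
  then have "AE y in lborel. (\<lambda>n. tag_step g (D n) y) \<longlonglongrightarrow> indicator (cbox u v) y * g y"
    using cont
  proof eventually_elim
    case (elim y)
    show ?case
    proof (cases "y \<in> cbox u v")
      case False
      then have "tag_step g (D n) y = 0" for n
        using tag_step_bound[OF D[of n] M, where y = y] by simp
      then show ?thesis using False by simp
    next
      case True
      \<comment> \<open>Off all cell boundaries, \<open>y\<close> is interior to the cell containing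
        it, and the tag of that cell is within its diameter of \<open>y\<close>. The tags therefore
        tend to \<open>y\<close>, where \<open>g\<close> is continuous.\<close>
      have "\<exists>x. tag_step g (D n) y = g x \<and> dist x y \<le> inverse (real (Suc n))" for n
      proof -
        obtain x K where xK: "(x, K) \<in> D n" "y \<in> K"
          using tagged_division_ofD(6)[OF D[of n]] True by blast
        obtain p q where K: "K = cbox p q" using tagged_division_ofD(4)[OF D xK(1)] by blast
        have "y \<in> interior K"
          using elim(1) xK K by (force simp: frontier_def)
        moreover have "dist x y \<le> diameter K"
          using tagged_division_ofD(2)[OF D xK(1)] xK(2) K by (intro diameter_bounded_bound) auto
        ultimately show ?thesis
          using tag_step_inside[OF D xK(1), where y = y and g = g] small[OF xK(1)]
          by (intro exI[of _ x]) auto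
      qed
      then obtain t where t: "\<And>n. tag_step g (D n) y = g (t n)"
        "\<And>n. dist (t n) y \<le> inverse (real (Suc n))" by metis
      have "t \<longlonglongrightarrow> y"
        by (rule metric_tendsto_imp_tendsto[OF LIMSEQ_inverse_real_of_nat])
          (use t(2) in auto)
      then have "(\<lambda>n. g (t n)) \<longlonglongrightarrow> g y" using elim(2) by (rule isCont_tendsto_compose[rotated])
      then show ?thesis using True t(1) by simp
    qed
  qed
  then have "(\<lambda>n. integral\<^sup>L lborel (tag_step g (D n))) \<longlonglongrightarrow> ?I"
    by (rule integral_dominated_convergence[where w = "\<lambda>y. M * indicator (cbox u v) y", rotated 3])
      (use tag_step_bound[OF D M] in \<open>auto simp: emeasure_lborel_cbox_eq\<close>)
  then have "(\<lambda>n. ?R (D n)) \<longlonglongrightarrow> ?I" by (simp add: integral_tag_step[OF D])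
  then show False
    using LIMSEQ_D[OF _ \<open>e > 0\<close>] far by fastforce
qed

text \<open>Since \<open>g\<close> vanishes off \<open>S\<close>, cutting it down to a box
  containing \<open>S\<close> changes nothing, so all such boxes give the same integral.\<close>

lemma has_riemann_integral_AE_continuous:
  fixes f g :: "'a::euclidean_space \<Rightarrow> real"
  assumes g: "\<And>x. g x = (if x \<in> S then f x else 0)"
    and "bounded S" "g \<in> borel_measurable borel" "\<And>x. \<bar>g x\<bar> \<le> M" "AE x in lborel. isCont g x"
  shows "(f has_riemann_integral integral\<^sup>L lborel g) S"
  unfolding has_riemann_integral_def
proof (intro conjI allI impI)
  fix u v assume "S \<subseteq> cbox u v"
  then have "indicator (cbox u v) x * g x = g x" for x
    by (auto simp: g indicator_def)
  then have "(\<lambda>x. indicator (cbox u v) x * g x) = g" by (rule ext)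
  then show "has_riemann_integral_box (\<lambda>x. if x \<in> S then f x else 0) (integral\<^sup>L lborel g) u v"
    using has_riemann_integral_box_AE_continuous[OF assms(3-5), of u v]
    by (simp del: mult_eq_0_iff flip: g)
qed fact

section \<open>Continuity and measurability of extensions by zero\<close>

lemma isCont_if_continuous_on_open:
  assumes "open T" "y \<in> T" "continuous_on T h" "\<And>z. z \<in> T \<Longrightarrow> g z = h z"
  shows "isCont g y"
proof -
  have "continuous_on T g" using assms(3,4) by (simp cong: continuous_on_cong)
  then show ?thesis using assms(1,2) by (simp add: continuous_on_eq_continuous_at)
qed

lemma borel_measurable_extend_zero:
  fixes f :: "'a::topological_space \<Rightarrow> real"
  assumes "S \<in> sets borel" "continuous_on S f"
  shows "(\<lambda>x. if x \<in> S then f x else 0) \<in> borel_measurable borel"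
proof -
  have "(\<lambda>x. indicator S x *\<^sub>R f x) \<in> borel_measurable borel"
    using assms by (rule borel_measurable_continuous_on_indicator)
  moreover have "(\<lambda>x. indicator S x *\<^sub>R f x) = (\<lambda>x. if x \<in> S then f x else 0)"
    by auto
  ultimately show ?thesis by simp
qed

text \<open>Away from the frontier the extension is locally \<open>f\<close> or locally 0. The
  freedom in \<open>A\<close> covers both the extension from the whole set and that from its
  interior.\<close>

lemma isCont_extend_zero:
  fixes f :: "'a::t2_space \<Rightarrow> real"
  assumes "continuous_on (interior S) f" "x \<notin> frontier S" "interior S \<subseteq> A" "A \<subseteq> S"
  shows "isCont (\<lambda>x. if x \<in> A then f x else 0) x"
proof (cases "x \<in> interior S")
  case True
  then show ?thesis
    using assms by (intro isCont_if_continuous_on_open[of "interior S" _ f]) auto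
next
  case False
  then have "x \<in> - closure S" using assms(2) by (auto simp: frontier_def)
  then show ?thesis
    using assms(4) closure_subset[of S]
    by (intro isCont_if_continuous_on_open[of "- closure S" _ "\<lambda>_. 0"]) auto
qed

section \<open>Square coverings\<close>

text \<open>Subadditivity over a finite cover bounds the measure by its total area, which can be
  made arbitrarily small.\<close>

lemma jordan_measure_zero_null:
  assumes "jordan_measure_zero A" "A \<in> sets borel"
  shows "A \<in> null_sets lborel"
proof -
  have "emeasure lborel A \<le> ennreal e" if "e > 0" for e
  proof -
    obtain F where "square_cover A e F"
      using assms(1) \<open>e > 0\<close> unfolding jordan_measure_zero_def by blast
    then have F: "finite F" "\<And>Q. Q \<in> F \<Longrightarrow> axis_square Q" "A \<subseteq> \<Union>F"
      "(\<Sum>Q\<in>F. measure lborel Q) \<le> e"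
      by (simp_all add: square_cover_def)
    have Q: "compact Q" if QF: "Q \<in> F" for Q
    proof -
      obtain p q t where "Q = {p..p + t} \<times> {q..q + t}"
        using F(2)[OF QF] unfolding axis_square_def by blast
      then show ?thesis by (simp add: compact_Times)
    qed
    then have F_sets: "F \<subseteq> sets lborel"
      by (auto intro: borel_compact)
    have "\<Union>F \<in> sets lborel"
      by (rule sets.finite_Union[OF F(1) F_sets])
    then have "emeasure lborel A \<le> emeasure lborel (\<Union>F)"
      by (rule emeasure_mono[OF F(3)])
    also have "\<dots> \<le> (\<Sum>Q\<in>F. emeasure lborel Q)"
      using emeasure_subadditive_finite[OF F(1), of "\<lambda>Q. Q" lborel] F_sets
      by (simp only: image_ident)
    also have "\<dots> = (\<Sum>Q\<in>F. ennreal (measure lborel Q))"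
    proof (rule sum.cong[OF refl])
      fix Q assume "Q \<in> F"
      then have "emeasure lborel Q < \<infinity>" using Q emeasure_compact_finite by blast
      then show "emeasure lborel Q = ennreal (measure lborel Q)"
        by (intro emeasure_eq_ennreal_measure) simp
    qed
    also have "\<dots> \<le> ennreal e"
      using F(4) by (simp add: sum_ennreal ennreal_leI)
    finally show ?thesis .
  qed
  then have "emeasure lborel A \<le> 0"
    by - (rule ennreal_le_epsilon, simp)
  then have "emeasure lborel A = 0" by simp
  then show ?thesis using assms(2) by (intro null_setsI) simp_all
qed

lemma measure_axis_square:
  assumes "s > 0"
  shows "measure lborel ({p..p + s} \<times> {q..q + s} :: (real \<times> real) set) = s * s"
proof -
  have "({p..p + s} \<times> {q..q + s} :: (real \<times> real) set) = cbox (p, q) (p + s, q + s)"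
    by (auto simp: cbox_Pair_eq)
  then show ?thesis
    using assms by (simp add: content_Pair)
qed

text \<open>One square has at most the total area \<open>e\<close>, hence side at most
  \<open>sqrt e\<close>. The factor 2 comes from bounding the Euclidean distance by the sum of the
  coordinate distances.\<close>

lemma square_cover_dist:
  assumes "square_cover A e F" "Q \<in> F" "z \<in> Q" "w \<in> Q"
  shows "dist z w \<le> 2 * sqrt e"
proof -
  obtain p q s where s: "s > 0" "Q = {p..p + s} \<times> {q..q + s}"
    using assms unfolding square_cover_def axis_square_def by blast
  have "s * s = measure lborel Q" using s measure_axis_square by simp
  also have "\<dots> \<le> (\<Sum>Q\<in>F. measure lborel Q)"
    using assms by (intro member_le_sum) (auto simp: square_cover_def)
  also have "\<dots> \<le> e" using assms by (simp add: square_cover_def)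
  finally have "s \<le> sqrt e" by (intro real_le_rsqrt) (simp add: power2_eq_square)
  obtain z1 z2 w1 w2 where zw: "z = (z1, z2)" "w = (w1, w2)" by fastforce
  have "dist z w \<le> \<bar>z1 - w1\<bar> + \<bar>z2 - w2\<bar>"
    unfolding zw dist_Pair_Pair dist_real_def using sqrt_sum_squares_le_sum_abs by simp
  also have "\<dots> \<le> 2 * s" using assms(3,4) zw s by auto
  finally show ?thesis using \<open>s \<le> sqrt e\<close> by linarith
qed

lemma nested_square_coveringsE:
  assumes "nested_square_coverings \<Omega> E" "e > 0"
  obtains F where "E e = \<Union>F" "square_cover (frontier \<Omega>) e F"
    "\<And>Q. Q \<in> F \<Longrightarrow> Q \<inter> frontier \<Omega> \<noteq> {}"
proof -
  from assms(1)[unfolded nested_square_coverings_def, THEN conjunct1, THEN spec, THEN mp, OF assms(2)]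
  obtain F where "E e = \<Union>F" "square_cover (frontier \<Omega>) e F" "\<forall>Q\<in>F. Q \<inter> frontier \<Omega> \<noteq> {}"
    by (elim exE conjE)
  then show thesis by (intro that[of F]) simp_all
qed

text \<open>Every square meets the frontier and has diameter at most \<open>2 * sqrt e\<close>. Once
  this is below the radius of a ball around \<open>z\<close> missing the frontier, no square can
  contain \<open>z\<close>.\<close>

lemma nested_square_coverings_leave:
  assumes "nested_square_coverings \<Omega> E" "z \<notin> frontier \<Omega>"
  shows "\<forall>\<^sub>F e in at_right 0. z \<notin> E e"
proof -
  have "open (- frontier \<Omega>)" using frontier_closed by (rule open_Compl)
  then obtain r where "r > 0" "ball z r \<subseteq> - frontier \<Omega>"
    using assms(2) open_contains_ball by blast
  then have r: "r > 0" "ball z r \<inter> frontier \<Omega> = {}" by auto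
  have "((\<lambda>e. 2 * sqrt e) \<longlongrightarrow> 2 * sqrt 0) (at_right 0)"
    by (intro tendsto_intros)
  then have "\<forall>\<^sub>F e in at_right 0. 2 * sqrt e < r"
    using r(1) by (intro order_tendstoD(2)) auto
  with eventually_at_right_less[of 0] show ?thesis
  proof eventually_elim
    case (elim e)
    obtain F where F: "E e = \<Union>F" "square_cover (frontier \<Omega>) e F"
      "\<And>Q. Q \<in> F \<Longrightarrow> Q \<inter> frontier \<Omega> \<noteq> {}"
      using nested_square_coveringsE[OF assms(1) elim(1)] by metis
    show ?case
    proof
      assume "z \<in> E e"
      then obtain Q where Q: "Q \<in> F" "z \<in> Q" using F(1) by blast
      then obtain w where w: "w \<in> Q" "w \<in> frontier \<Omega>" using F(3) by blast
      have "dist z w < r" using square_cover_dist[OF F(2) Q w(1)] elim(2) by linarith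
      then show False using r(2) w(2) by auto
    qed
  qed
qed

section \<open>Vertical slices of squares, coverings and open sets\<close>

lemma square_slice:
  assumes "axis_square Q"
  shows "closed (slice Q x)" "finite (frontier (slice Q x))"
proof -
  obtain p q s where "s > 0" "Q = {p..p + s} \<times> {q..q + s}"
    using assms unfolding axis_square_def by blast
  then have "slice Q x = (if x \<in> {p..p + s} then {q..q + s} else {})"
    by (auto simp: slice_def)
  then show "closed (slice Q x)" "finite (frontier (slice Q x))"
    using \<open>s > 0\<close> by (auto simp: frontier_def interior_atLeastAtMost_real)
qed

lemma slice_Union: "slice (\<Union>F) x = (\<Union>Q\<in>F. slice Q x)"
  by (auto simp: slice_def)

lemma closed_slice_covering:
  assumes "nested_square_coverings \<Omega> E" "e > 0"
  shows "closed (slice (E e) x)"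
proof -
  obtain F where F: "E e = \<Union>F" "square_cover (frontier \<Omega>) e F"
    using nested_square_coveringsE[OF assms] by metis
  then show ?thesis
    unfolding F(1) slice_Union using square_slice(1) by (auto simp: square_cover_def)
qed

lemma open_slice: "open A \<Longrightarrow> open (slice A x)"
proof -
  assume "open A"
  then have "open ((\<lambda>y. (x, y)) -` A)"
    by (intro open_vimage continuous_intros) auto
  then show ?thesis by (simp add: slice_def vimage_def)
qed

lemma slice_continuous:
  assumes "continuous_on S f"
  shows "continuous_on (slice S x) (\<lambda>y. f (x, y))"
proof (rule continuous_on_compose2[OF assms])
  show "continuous_on (slice S x) (Pair x)"
    by (intro continuous_on_Pair continuous_on_const continuous_on_id)
  show "Pair x ` slice S x \<subseteq> S" by (auto simp: slice_def)
qed

section \<open>The inner and the outer integral\<close>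

context
  fixes \<Omega> :: "(real \<times> real) set" and f :: "real \<times> real \<Rightarrow> real"
    and E :: "real \<Rightarrow> (real \<times> real) set" and M c d :: real
  assumes dom: "closed_jordan_domain \<Omega>"
    and cont: "continuous_on \<Omega> f"
    and bound: "\<And>z. z \<in> \<Omega> \<Longrightarrow> \<bar>f z\<bar> \<le> M"
    and box: "\<Omega> \<subseteq> {-c..c} \<times> {-d..d}"
    and M_nonneg: "0 \<le> M"
    and cover: "nested_square_coverings \<Omega> E"
begin

text \<open>Extension from the interior rather than from \<Omega>, because the inner integrals run
  over slices of the interior. The two extensions can differ only on the null frontier.\<close>

definition interior_ext :: "real \<times> real \<Rightarrow> real"
  where "interior_ext z = (if z \<in> interior \<Omega> then f z else 0)"

text \<open>The prospective value of the improper inner integral, defined for every \<open>x\<close>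
  without reference to \<open>E\<close>.\<close>

definition lebesgue_inner :: "real \<Rightarrow> real"
  where "lebesgue_inner x = (LINT y|lborel. interior_ext (x, y))"

section \<open>Measurability and bounds of the integrand\<close>

lemma cont_interior: "continuous_on (interior \<Omega>) f"
  using cont continuous_on_subset interior_subset by blast

lemma frontier_null: "frontier \<Omega> \<in> null_sets lborel"
  using dom by (intro jordan_measure_zero_null)
    (auto simp: closed_jordan_domain_def intro: borel_closed)

lemma interior_ext_measurable [measurable]: "interior_ext \<in> borel_measurable borel"
  unfolding interior_ext_def[abs_def]
  by (intro borel_measurable_extend_zero cont_interior) auto

lemma interior_ext_measurable_pair [measurable]:
  "interior_ext \<in> borel_measurable (borel \<Otimes>\<^sub>M borel)"
  using interior_ext_measurable by (simp add: borel_prod)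

text \<open>The majorant is a product, so it serves in the plane and, after dropping the factor in
  \<open>x\<close>, on every slice uniformly.\<close>

lemma interior_ext_bound:
  "\<bar>interior_ext (x, y)\<bar> \<le> M * (indicator {-c..c} x * indicator {-d..d} y)"
proof (cases "(x, y) \<in> interior \<Omega>")
  case True
  then have "(x, y) \<in> \<Omega>" using interior_subset by blast
  then have "\<bar>f (x, y)\<bar> \<le> M" "x \<in> {-c..c}" "y \<in> {-d..d}" using bound box by blast+
  then show ?thesis using True by (simp add: interior_ext_def)
next
  case False
  then show ?thesis using M_nonneg by (simp add: interior_ext_def)
qed

lemma interior_ext_bound_slice: "\<bar>interior_ext (x, y)\<bar> \<le> M * indicator {-d..d} y"
  by (rule order_trans[OF interior_ext_bound]) (simp add: indicator_def M_nonneg)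

lemma integrable_interior_ext: "integrable lborel interior_ext"
proof (rule Bochner_Integration.integrable_bound)
  have "integrable lborel (indicator (cbox (-c, -d) (c, d)) :: real \<times> real \<Rightarrow> real)"
    by (simp add: emeasure_lborel_cbox_eq)
  then show "integrable lborel (\<lambda>z. M * indicator (cbox (-c, -d) (c, d)) z :: real)"
    by simp
  show "AE z in lborel. norm (interior_ext z) \<le> norm (M * indicator (cbox (-c, -d) (c, d)) z :: real)"
  proof (rule AE_I2)
    fix z :: "real \<times> real"
    show "norm (interior_ext z) \<le> norm (M * indicator (cbox (-c, -d) (c, d)) z :: real)"
      using interior_ext_bound[of "fst z" "snd z"] M_nonneg
      by (cases z) (auto simp: indicator_def cbox_Pair_eq split: if_splits)
  qed
qed simp

section \<open>The Lebesgue inner integral as a function of \<open>x\<close>\<close>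

lemma lebesgue_inner_measurable: "lebesgue_inner \<in> borel_measurable borel"
  unfolding lebesgue_inner_def[abs_def] by measurable

lemma integral_lebesgue_inner: "(LINT x|lborel. lebesgue_inner x) = integral\<^sup>L lborel interior_ext"
  unfolding lebesgue_inner_def
  using lborel_pair.integral_fst'[of interior_ext] integrable_interior_ext
  by (simp add: lborel_prod)

lemma lebesgue_inner_bound: "\<bar>lebesgue_inner x\<bar> \<le> M * measure lborel {-d..d}"
proof -
  have "\<bar>lebesgue_inner x\<bar> \<le> (LINT y|lborel. \<bar>interior_ext (x, y)\<bar>)"
    unfolding lebesgue_inner_def by (rule integral_abs_bound)
  also have "\<dots> \<le> (LINT y|lborel. M * indicator {-d..d} y)"
    by (rule integral_mono_AE')
      (use interior_ext_bound_slice in \<open>auto simp: emeasure_lborel_Icc_eq M_nonneg\<close>)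
  also have "\<dots> = M * measure lborel {-d..d}" by simp
  finally show ?thesis .
qed

lemma AE_isCont_lebesgue_inner: "AE x in lborel. isCont lebesgue_inner x"
proof -
  \<comment> \<open>Almost every slice of a null set in the plane is null. Continuity is shown at
    each \<open>x\<close> whose frontier slice is null.\<close>
  have "AE z in lborel \<Otimes>\<^sub>M lborel. z \<notin> frontier \<Omega>"
    unfolding lborel_prod by (rule AE_not_in[OF frontier_null])
  then have "AE x in lborel. AE y in lborel. (x, y) \<notin> frontier \<Omega>"
    by (rule lborel_pair.AE_pair)
  then show ?thesis
  proof eventually_elim
    case (elim x)
    show ?case
    proof (rule continuous_at_sequentiallyI)
      fix s assume s: "s \<longlonglongrightarrow> x"
      \<comment> \<open>The exceptional \<open>y\<close> depend on \<open>x\<close> only and not on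
        the sequence, since convergence comes from continuity of \<open>interior_ext\<close> in the
        plane at \<open>(x, y)\<close>.\<close>
      have "AE y in lborel. (\<lambda>n. interior_ext (s n, y)) \<longlonglongrightarrow> interior_ext (x, y)"
        using elim
      proof eventually_elim
        case (elim y)
        then have "isCont interior_ext (x, y)"
          unfolding interior_ext_def[abs_def]
          by (rule isCont_extend_zero[OF cont_interior _ order.refl interior_subset])
        moreover have "(\<lambda>n. (s n, y)) \<longlonglongrightarrow> (x, y)" using s by (intro tendsto_intros)
        ultimately show ?case by (rule isCont_tendsto_compose)
      qed
      then show "(\<lambda>n. lebesgue_inner (s n)) \<longlonglongrightarrow> lebesgue_inner x"
        unfolding lebesgue_inner_def
        by (rule integral_dominated_convergence[where w = "\<lambda>y. M * indicator {-d..d} y", rotated 3])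
          (use interior_ext_bound_slice in \<open>auto simp: emeasure_lborel_Icc_eq\<close>)
    qed
  qed
qed

text \<open>Holds for every \<open>x\<close>, even if the frontier slice has positive measure:
  \<open>E e\<close> covers the frontier, so removing it leaves only the end points of finitely many
  intervals as possible discontinuities.\<close>

lemma has_riemann_integral_slice:
  assumes "e > 0"
  shows "((\<lambda>y. f (x, y)) has_riemann_integral
    (LINT y|lborel. (if y \<in> slice (E e) x then 0 else interior_ext (x, y))))
    (slice (interior \<Omega>) x - slice (E e) x)"
proof -
  define S where "S = slice (interior \<Omega>) x - slice (E e) x"
  define k where "k = (\<lambda>y. if y \<in> S then f (x, y) else 0)"
  obtain F where F: "E e = \<Union>F" "square_cover (frontier \<Omega>) e F"
    using nested_square_coveringsE[OF cover assms] by metis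
  then have F': "finite F" "\<And>Q. Q \<in> F \<Longrightarrow> axis_square Q" "frontier \<Omega> \<subseteq> \<Union>F"
    by (simp_all add: square_cover_def)
  have slice_E: "slice (E e) x = (\<Union>Q\<in>F. slice Q x)"
    using F(1) slice_Union by simp
  have "open S"
    unfolding S_def
    by (intro open_Diff open_slice closed_slice_covering[OF cover assms] open_interior)
  have S_f: "continuous_on S (\<lambda>y. f (x, y))"
    unfolding S_def using slice_continuous[OF cont_interior] continuous_on_subset by blast
  have k_eq: "k = (\<lambda>y. if y \<in> slice (E e) x then 0 else interior_ext (x, y))"
    by (auto simp: k_def S_def interior_ext_def slice_def)
  have isCont: "isCont k y" if y: "y \<notin> (\<Union>Q\<in>F. frontier (slice Q x))" for y
  proof (cases "y \<in> slice (E e) x")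
    case True
    then obtain Q where Q: "Q \<in> F" "y \<in> slice Q x" using slice_E by blast
    \<comment> \<open>Not being an end point, \<open>y\<close> has a neighbourhood inside the slice
      of a single square, on which \<open>k\<close> is 0.\<close>
    then have "y \<in> interior (slice Q x)"
      using y closure_subset[of "slice Q x"] by (auto simp: frontier_def)
    moreover have "interior (slice Q x) \<subseteq> slice (E e) x"
      using Q(1) slice_E interior_subset by blast
    ultimately show ?thesis
      by (intro isCont_if_continuous_on_open[of "interior (slice Q x)" _ "\<lambda>_. 0"])
        (auto simp: k_eq)
  next
    case False
    show ?thesis
    proof (cases "y \<in> S")
      case True
      then show ?thesis
        using \<open>open S\<close> S_f by (intro isCont_if_continuous_on_open[of S]) (auto simp: k_def)
    next
      assume "y \<notin> S"
      \<comment> \<open>A point of \<Omega> outside the interior would lie on the frontier, hence in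
        \<open>E e\<close>. As \<Omega> is closed, \<open>k\<close> vanishes near
        \<open>y\<close>.\<close>
      have "(x, y) \<notin> \<Omega>"
        using \<open>y \<notin> S\<close> False F(1) F'(3) closure_subset[of \<Omega>]
        by (auto simp: S_def slice_def frontier_def)
      then have "y \<in> slice (- \<Omega>) x" by (simp add: slice_def)
      moreover have "open (slice (- \<Omega>) x)"
        using dom by (intro open_slice) (auto simp: closed_jordan_domain_def)
      ultimately show ?thesis
        using interior_subset[of \<Omega>]
        by (intro isCont_if_continuous_on_open[of "slice (- \<Omega>) x" _ "\<lambda>_. 0"])
          (auto simp: k_def S_def slice_def)
    qed
  qed
  have "finite (\<Union>Q\<in>F. frontier (slice Q x))"
    using F'(1,2) square_slice(2) by auto
  then have "AE y in lborel. y \<notin> (\<Union>Q\<in>F. frontier (slice Q x))"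
    by (intro AE_not_in finite_imp_null_set_lborel)
  then have "AE y in lborel. isCont k y"
    by eventually_elim (rule isCont)
  moreover have "S \<subseteq> {-d..d}"
    using box interior_subset[of \<Omega>] by (auto simp: S_def slice_def)
  moreover have "\<bar>k y\<bar> \<le> M" for y
    using bound interior_subset[of \<Omega>] M_nonneg by (auto simp: k_def S_def slice_def)
  moreover have "k \<in> borel_measurable borel"
    unfolding k_def using \<open>open S\<close> S_f by (intro borel_measurable_extend_zero) auto
  ultimately have "((\<lambda>y. f (x, y)) has_riemann_integral integral\<^sup>L lborel k) S"
    by (intro has_riemann_integral_AE_continuous[where M = M])
      (auto simp: k_def intro: bounded_subset[OF bounded_closed_interval])
  then show ?thesis unfolding k_eq S_def .
qed

text \<open>Dominated convergence along an arbitrary sequence of positive numbers tending to 0. It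
  works at every \<open>x\<close>, because the integrands converge at every
  \<open>y\<close>.\<close>

lemma tendsto_inner_integral_approx:
  "(inner_integral_approx \<Omega> E f x \<longlongrightarrow> lebesgue_inner x) (at_right 0)"
proof (rule tendsto_at_iff_sequentially[THEN iffD2], intro allI impI)
  fix s :: "nat \<Rightarrow> real" assume s: "\<forall>i. s i \<in> {0<..} - {0}" "s \<longlonglongrightarrow> 0"
  let ?k = "\<lambda>n y. if y \<in> slice (E (s n)) x then 0 else interior_ext (x, y)"
  have s_lim: "filterlim s (at_right 0) sequentially"
    using s by (auto simp: filterlim_at order_less_imp_not_eq2)
  \<comment> \<open>Interior points eventually leave the coverings, so the sequence becomes
    constant; at all other points every term is already 0.\<close>
  have "(\<lambda>n. ?k n y) \<longlonglongrightarrow> interior_ext (x, y)" for y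
  proof (cases "(x, y) \<in> interior \<Omega>")
    case True
    then have "(x, y) \<notin> frontier \<Omega>" by (simp add: frontier_def)
    then have "\<forall>\<^sub>F n in sequentially. (x, y) \<notin> E (s n)"
      using nested_square_coverings_leave[OF cover] s_lim filterlim_iff by fast
    then have "\<forall>\<^sub>F n in sequentially. ?k n y = interior_ext (x, y)"
      by eventually_elim (simp add: slice_def)
    then show ?thesis by (rule tendsto_eventually)
  next
    case False
    then have "?k n y = interior_ext (x, y)" for n by (simp add: interior_ext_def)
    then show ?thesis by simp
  qed
  moreover have "?k n \<in> borel_measurable borel" for n
  proof -
    have "closed (slice (E (s n)) x)"
      using closed_slice_covering[OF cover] s(1) by simp
    then have [measurable]: "slice (E (s n)) x \<in> sets borel" by (rule borel_closed)
    show ?thesis by measurable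
  qed
  moreover have "norm (?k n y) \<le> M * indicator {-d..d} y" for n y
    using interior_ext_bound_slice[of x y] M_nonneg by (auto simp: indicator_def)
  ultimately have "(\<lambda>n. LINT y|lborel. ?k n y) \<longlonglongrightarrow> (LINT y|lborel. interior_ext (x, y))"
    by (intro integral_dominated_convergence[where w = "\<lambda>y. M * indicator {-d..d} y"])
      (auto simp: emeasure_lborel_Icc_eq)
  moreover have "inner_integral_approx \<Omega> E f x (s n) = (LINT y|lborel. ?k n y)" for n
    unfolding inner_integral_approx_def
    using s(1) by (intro riemann_integral_unique has_riemann_integral_slice) auto
  ultimately show "(inner_integral_approx \<Omega> E f x \<circ> s) \<longlonglongrightarrow> lebesgue_inner x"
    by (simp add: o_def lebesgue_inner_def)
qed

section \<open>Identification of the repeated and the double integral\<close>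

lemma inner_integral_eq: "inner_integral \<Omega> E f = lebesgue_inner"
proof
  show "inner_integral \<Omega> E f x = lebesgue_inner x" for x
    unfolding inner_integral_def
    by (rule tendsto_Lim[OF _ tendsto_inner_integral_approx]) simp
qed

lemma inner_integrable: "inner_integrable \<Omega> E f x"
  unfolding inner_integrable_def riemann_integrable_on_def
proof (intro conjI allI impI)
  show "\<exists>I. ((\<lambda>y. f (x, y)) has_riemann_integral I) (slice (interior \<Omega>) x - slice (E e) x)"
    if "e > 0" for e
    using has_riemann_integral_slice[OF that] by (rule exI)
  show "\<exists>L. (inner_integral_approx \<Omega> E f x \<longlongrightarrow> L) (at_right 0)"
    using tendsto_inner_integral_approx by (rule exI)
qed

text \<open>Slices of the interior over points outside \<open>{a..b}\<close> are empty, so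
  \<open>lebesgue_inner\<close> is its own extension by zero. Fubini turns its integral into that of
  \<open>interior_ext\<close>.\<close>

lemma has_riemann_integral_inner:
  assumes "\<And>x y. (x, y) \<in> interior \<Omega> \<Longrightarrow> x \<in> {a..b}"
  shows "(inner_integral \<Omega> E f has_riemann_integral integral\<^sup>L lborel interior_ext) {a..b}"
proof -
  have "(lebesgue_inner has_riemann_integral integral\<^sup>L lborel lebesgue_inner) {a..b}"
  proof (rule has_riemann_integral_AE_continuous)
    show "lebesgue_inner x = (if x \<in> {a..b} then lebesgue_inner x else 0)" for x
    proof (cases "x \<in> {a..b}")
      case False
      then have "interior_ext (x, y) = 0" for y
        using assms by (auto simp: interior_ext_def)
      then show ?thesis using False by (simp add: lebesgue_inner_def)
    qed simp
  qed (rule bounded_closed_interval lebesgue_inner_measurable lebesgue_inner_bound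
      AE_isCont_lebesgue_inner)+
  then show ?thesis by (simp only: inner_integral_eq integral_lebesgue_inner)
qed

lemma has_riemann_integral_double:
  "(f has_riemann_integral integral\<^sup>L lborel interior_ext) \<Omega>"
proof -
  define g where "g = (\<lambda>z. if z \<in> \<Omega> then f z else 0)"
  have AE: "AE z in lborel. z \<notin> frontier \<Omega>" by (rule AE_not_in[OF frontier_null])
  have g: "g \<in> borel_measurable borel"
    unfolding g_def using dom cont
    by (intro borel_measurable_extend_zero) (auto simp: closed_jordan_domain_def)
  have "AE z in lborel. isCont g z"
    using AE unfolding g_def
    by eventually_elim (intro isCont_extend_zero[OF cont_interior] interior_subset order.refl)
  moreover have "bounded \<Omega>" using dom by (simp add: closed_jordan_domain_def)
  ultimately have "(f has_riemann_integral integral\<^sup>L lborel g) \<Omega>"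
    using g bound M_nonneg
    by (intro has_riemann_integral_AE_continuous[where M = M]) (auto simp: g_def)
  \<comment> \<open>The integrands agree off the null frontier; this brings the double integral to
    the same value as the repeated one.\<close>
  moreover have "integral\<^sup>L lborel g = integral\<^sup>L lborel interior_ext"
  proof (rule integral_cong_AE)
    show "AE z in lborel. g z = interior_ext z"
      using AE
    proof eventually_elim
      case (elim z)
      then show ?case
        using closure_subset[of \<Omega>] interior_subset[of \<Omega>]
        by (auto simp: g_def interior_ext_def frontier_def)
    qed
  qed (use g in auto)
  ultimately show ?thesis by simp
qed

end

theorem theorem3:
  fixes \<Omega> \<Omega>\<^sub>0 :: "(real \<times> real) set"
    and f :: "real \<times> real \<Rightarrow> real"
    and E :: "real \<Rightarrow> (real \<times> real) set"
    and a b :: real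
  assumes "closed_jordan_domain \<Omega>"
    and "open \<Omega>\<^sub>0" and "\<Omega> \<subseteq> \<Omega>\<^sub>0"
    and "continuous_on \<Omega>\<^sub>0 f" and "bounded (f ` \<Omega>\<^sub>0)"
    and "a = Inf {x. \<exists>y. (x, y) \<in> interior \<Omega>}"
    and "b = Sup {x. \<exists>y. (x, y) \<in> interior \<Omega>}"
    and "nested_square_coverings \<Omega> E"
  shows "f riemann_integrable_on \<Omega> \<and>
    (\<forall>x\<in>{a..b}. inner_integrable \<Omega> E f x) \<and>
    inner_integral \<Omega> E f riemann_integrable_on {a..b} \<and>
    riemann_integral \<Omega> f = riemann_integral {a..b} (inner_integral \<Omega> E f)"
proof -
  have cont: "continuous_on \<Omega> f" using assms(3,4) continuous_on_subset by blast
  obtain M where M: "M > 0" "\<And>z. z \<in> \<Omega>\<^sub>0 \<Longrightarrow> \<bar>f z\<bar> \<le> M"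
    using assms(5) by (auto simp: bounded_pos)
  then have bound: "\<bar>f z\<bar> \<le> M" if "z \<in> \<Omega>" for z using that assms(3) by blast
  have "bounded \<Omega>" using assms(1) by (simp add: closed_jordan_domain_def)
  then obtain w where "\<Omega> \<subseteq> cbox (- w) w" using bounded_subset_cbox_symmetric by blast
  then obtain c d where box: "\<Omega> \<subseteq> {-c..c} \<times> {-d..d}"
    by (cases w) (auto simp: cbox_Pair_eq)
  note ctx = assms(1) cont bound box order.strict_implies_order[OF M(1)] assms(8)
  \<comment> \<open>\<open>Inf\<close> and \<open>Sup\<close> on the reals are genuine bounds only
    for bounded sets; here the enclosing box bounds the projection.\<close>
  have ab: "x \<in> {a..b}" if "(x, y) \<in> interior \<Omega>" for x y
  proof -
    let ?X = "{x. \<exists>y. (x, y) \<in> interior \<Omega>}"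
    have "?X \<subseteq> {-c..c}" using box interior_subset[of \<Omega>] by blast
    then have "bdd_below ?X" "bdd_above ?X"
      using bdd_below_mono[OF bdd_below_Icc] bdd_above_mono[OF bdd_above_Icc] by metis+
    then show ?thesis using that assms(6,7) by (auto intro!: cInf_lower cSup_upper)
  qed
  note double = has_riemann_integral_double[OF ctx]
  have inner: "(inner_integral \<Omega> E f has_riemann_integral integral\<^sup>L lborel (interior_ext \<Omega> f)) {a..b}"
    using has_riemann_integral_inner[OF ctx] ab by blast
  show ?thesis
    using double inner inner_integrable[OF ctx] riemann_integral_unique[OF double]
      riemann_integral_unique[OF inner]
    unfolding riemann_integrable_on_def by auto
qed

end
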